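(* Let $n \geq 1$. Then \[ \mathcal{S}_{(n,n)}(x) = \binom{2n}{n}^{-1} \sum_{k=0}^{n} \binom{2n}{k} (-1)^{n-k} x^k, \] and these polynomials obey the recurrence \[ 2\mathcal{S}_{(n+1,n+1)}(x) = \frac{n+1}{2n+1} (x-1) \left( x^{n+1} - (x-1) \mathcal{S}_{(n,n)}(x)\right) + x^{n+1} \] with $\mathcal{S}_{(1,1)}(x) = x - \frac{1}{2}$. For every $\ell \in \mathbb{Z}$ we have $\mathcal{S}_{(n,n)}(\ell) \notin \mathbb{Z}$; more precisely, \[ \operatorname{ord}_2(\operatorname{denom}(\mathcal{S}_{(n,n)}(\ell))) = \begin{cases} 1, & \text{if $\ell$ is odd},\\ s_2(n), & \text{if $\ell$ is even}. \end{cases} \]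
   Context: For integers $n, r \geq 0$, $\mathcal{S}_{(r,n)}(x) = \sum_{k=0}^{n} \binom{n}{k} (-1)^k x^{n-k} \binom{r+k}{r}^{-1} \in \mathbb{Q}[x]$. $\operatorname{denom}(q)$ is the denominator of a rational $q$ in lowest terms, $\operatorname{ord}_2$ is the $2$-adic valuation, and $s_2(n)$ is the sum of the binary digits of $n$. *)

theory Defs
  imports "HOL-Computational_Algebra.Computational_Algebra"
begin

abbreviation indet :: "rat poly" where
  "indet \<equiv> [:0, 1:]"

definition S_poly :: "nat \<Rightarrow> nat \<Rightarrow> rat poly" where
  "S_poly r n =
     (\<Sum>k=0..n. smult (of_nat (n choose k) * (-1) ^ k * inverse (of_nat ((r + k) choose r)))
                     (indet ^ (n - k)))"

definition denom :: "rat \<Rightarrow> int" where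
  "denom q = snd (quotient_of q)"

fun binary_digit_sum :: "nat \<Rightarrow> nat" where
  "binary_digit_sum n = (if n = 0 then 0 else n mod 2 + binary_digit_sum (n div 2))"

declare binary_digit_sum.simps [simp del]

end

theory Submission
  imports Defs
begin

text \<open>
  The formula follows from \<open>(2n choose n) (n choose k) = (2n choose n-k) (n+k choose n)\<close>, and
  the recurrence from applying Pascal's rule twice to the truncated binomial sum
  \<open>\<Sum>k\<le>n. (2n choose k) y^k\<close> at \<open>y = -x\<close>. For even \<open>l\<close>, that sum is odd, so the denominator
  carries the full power of 2 in the central binomial coefficient, whose exponent is the digit
  sum of \<open>n\<close>. For odd \<open>l\<close>, the factor \<open>l - 1\<close> in the recurrence is even, and induction shows
  that \<open>2 S(l)\<close> is a quotient of odd integers.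
\<close>

section \<open>Explicit formula by binomial coefficients\<close>

lemma S_poly_central:
  "S_poly n n = smult (inverse (of_nat ((2 * n) choose n)))
     (\<Sum>k=0..n. smult (of_nat ((2 * n) choose k) * (-1) ^ (n - k)) (indet ^ k))"
proof -
  have coeff: "of_nat (n choose k) * (-1) ^ k * inverse (of_nat ((n + k) choose n))
      = inverse (of_nat ((2 * n) choose n)) * (of_nat ((2 * n) choose (n - k)) * (-1 :: rat) ^ k)"
    if "k \<le> n" for k
  proof -
    \<comment> \<open>Choosing \<open>n - k\<close> elements inside \<open>n\<close> inside
      \<open>2 * n\<close> is counted in two ways. Symmetry then puts both factors into the shape
      used in \<open>S_poly_def\<close>.\<close>
    have "((2 * n) choose n) * (n choose (n - k))
        = ((2 * n) choose (n - k)) * ((2 * n - (n - k)) choose (n - (n - k)))"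
      by (rule choose_mult) auto
    moreover have "2 * n - (n - k) = n + k" "n - (n - k) = k"
      using that by auto
    moreover have "n choose (n - k) = n choose k" "(n + k) choose k = (n + k) choose n"
      using that binomial_symmetric[of k n] binomial_symmetric[of k "n + k"] by simp_all
    ultimately have "((2 * n) choose n) * (n choose k)
        = ((2 * n) choose (n - k)) * ((n + k) choose n)"
      by simp
    then have "(of_nat ((2 * n) choose n) * of_nat (n choose k) :: rat)
        = of_nat ((2 * n) choose (n - k)) * of_nat ((n + k) choose n)"
      by (metis of_nat_mult)
    then show ?thesis
      by (simp add: field_simps)
  qed
  have "S_poly n n = (\<Sum>k=0..n. smult (inverse (of_nat ((2 * n) choose n)))
      (smult (of_nat ((2 * n) choose (n - k)) * (-1) ^ k) (indet ^ (n - k))))"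
    unfolding S_poly_def
    by (rule sum.cong) (simp_all only: coeff smult_smult atLeastAtMost_iff)
  also have "\<dots> = smult (inverse (of_nat ((2 * n) choose n)))
      (\<Sum>k=0..n. smult (of_nat ((2 * n) choose (n - k)) * (-1) ^ k) (indet ^ (n - k)))"
    by (rule poly_eqI) (simp only: coeff_smult coeff_sum sum_distrib_left)
  also have "(\<Sum>k=0..n. smult (of_nat ((2 * n) choose (n - k)) * (-1 :: rat) ^ k) (indet ^ (n - k)))
      = (\<Sum>k=0..n. smult (of_nat ((2 * n) choose k) * (-1) ^ (n - k)) (indet ^ k))"
    by (subst sum.atLeastAtMost_rev) (auto intro!: sum.cong)
  finally show ?thesis .
qed

section \<open>Truncated binomial sums and the recurrence\<close>

text \<open>Pascal's rule splits the sum in two. The shifted half is \<open>y\<close> times the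
  original sum except for its top term, which the truncation at \<open>j\<close> cuts off and which
  is therefore subtracted.\<close>

lemma sum_binomial_truncated_Suc:
  fixes y :: "'a :: comm_ring_1"
  shows "(\<Sum>k\<le>j. of_nat (Suc m choose k) * y ^ k)
    = (1 + y) * (\<Sum>k\<le>j. of_nat (m choose k) * y ^ k) - of_nat (m choose j) * y ^ Suc j"
  by (induction j) (simp_all add: algebra_simps)

text \<open>Pascal's rule leads from row \<open>2 * n + 2\<close> to \<open>2 * n + 1\<close> and
  then to \<open>2 * n\<close>. In between, the last term is split off, so that the truncation index
  drops to \<open>n\<close>.\<close>

lemma sum_central_binomial_truncated_Suc:
  fixes y :: "'a :: comm_ring_1"
  shows "(\<Sum>k\<le>Suc n. of_nat (2 * Suc n choose k) * y ^ k)
    = (1 + y)\<^sup>2 * (\<Sum>k\<le>n. of_nat (2 * n choose k) * y ^ k)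
      - (1 + y) * of_nat (2 * n choose n) * y ^ Suc n
      + of_nat (Suc (2 * n) choose Suc n) * y ^ Suc n"
proof -
  let ?A = "\<lambda>m j. \<Sum>k\<le>j. of_nat (m choose k) * y ^ k"
  let ?c = "of_nat (2 * n choose n) :: 'a" and ?d = "of_nat (Suc (2 * n) choose Suc n) :: 'a"
  have "?A (2 * Suc n) (Suc n) = (1 + y) * ?A (Suc (2 * n)) (Suc n) - ?d * y ^ Suc (Suc n)"
    using sum_binomial_truncated_Suc[of "Suc (2 * n)" y "Suc n"] by simp
  also have "?A (Suc (2 * n)) (Suc n) = ?A (Suc (2 * n)) n + ?d * y ^ Suc n"
    by (simp only: sum.atMost_Suc)
  also have "?A (Suc (2 * n)) n = (1 + y) * ?A (2 * n) n - ?c * y ^ Suc n"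
    by (rule sum_binomial_truncated_Suc)
  finally have *: "?A (2 * Suc n) (Suc n)
      = (1 + y) * ((1 + y) * ?A (2 * n) n - ?c * y ^ Suc n + ?d * y ^ Suc n)
        - ?d * y ^ Suc (Suc n)" .
  have "(1 + y) * ((1 + y) * a - c * z + d * z) - d * (y * z)
      = (1 + y)\<^sup>2 * a - (1 + y) * c * z + d * z" for a c d z :: 'a
    by (simp add: power2_eq_square algebra_simps)
  then show ?thesis
    unfolding * power_Suc[of y "Suc n"] .
qed

text \<open>The first part is Pascal's rule with its two summands equal by symmetry. Together the
  two parts relate consecutive central binomial coefficients, for the recurrence and for the 2-adic
  valuation.\<close>

lemma central_binomial_Suc:
  "2 * (Suc (2 * n) choose Suc n) = 2 * Suc n choose Suc n"
  "Suc n * (Suc (2 * n) choose Suc n) = Suc (2 * n) * (2 * n choose n)"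
proof -
  have "Suc (2 * n) choose n = Suc (2 * n) choose Suc n"
    using binomial_symmetric[of n "Suc (2 * n)"] by (simp del: binomial_Suc_Suc)
  then show "2 * (Suc (2 * n) choose Suc n) = 2 * Suc n choose Suc n"
    using binomial_Suc_Suc[of "Suc (2 * n)" n] by (simp del: binomial_Suc_Suc)
  show "Suc n * (Suc (2 * n) choose Suc n) = Suc (2 * n) * (2 * n choose n)"
    by (rule Suc_times_binomial)
qed

lemma poly_S_poly_central:
  "poly (S_poly n n) x
    = (-1) ^ n * (\<Sum>k\<le>n. of_nat (2 * n choose k) * (- x) ^ k) / of_nat (2 * n choose n)"
proof -
  have sign: "(-1) ^ (n - k) * x ^ k = (-1) ^ n * (- x) ^ k" if "k \<le> n" for k
  proof -
    have "(-1 :: rat) ^ n = (-1) ^ (n - k) * (-1) ^ k"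
      using that by (simp flip: power_add)
    moreover have "(-1 :: rat) ^ k * (-1) ^ k = 1"
      by (simp flip: power_add mult_2)
    ultimately show ?thesis
      by (simp add: power_minus[of x] mult.assoc)
  qed
  have "poly (S_poly n n) x
      = (\<Sum>k\<le>n. of_nat (2 * n choose k) * ((-1) ^ (n - k) * x ^ k)) / of_nat (2 * n choose n)"
    unfolding S_poly_central by (simp add: poly_sum atMost_atLeast0 field_simps)
  also have "(\<Sum>k\<le>n. of_nat (2 * n choose k) * ((-1) ^ (n - k) * x ^ k))
      = (\<Sum>k\<le>n. of_nat (2 * n choose k) * ((-1) ^ n * (- x) ^ k))"
    by (rule sum.cong) (simp_all only: sign atMost_iff)
  finally show ?thesis
    by (simp add: sum_distrib_left mult.left_commute)
qed

text \<open>Stated for values, this serves both the polynomial recurrence and the induction at odd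
  integers.\<close>

lemma poly_S_poly_central_Suc:
  "2 * poly (S_poly (Suc n) (Suc n)) x
    = of_nat (Suc n) / of_nat (Suc (2 * n))
        * ((x - 1) * (x ^ Suc n - (x - 1) * poly (S_poly n n) x)) + x ^ Suc n"
proof -
  define A where "A = (\<Sum>k\<le>n. of_nat (2 * n choose k) * (- x) ^ k)"
  define c d p q e :: rat where "c = of_nat (2 * n choose n)"
    and "d = of_nat (Suc (2 * n) choose Suc n)"
    and "p = of_nat (Suc n)" and "q = of_nat (Suc (2 * n))" and "e = (-1) ^ n"
  have nz: "c \<noteq> 0" "d \<noteq> 0" "q \<noteq> 0" "p \<noteq> 0"
    unfolding c_def d_def p_def q_def by (simp_all del: of_nat_Suc binomial_Suc_Suc)
  have pd: "p * d = q * c"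
    unfolding c_def d_def p_def q_def by (metis central_binomial_Suc(2) of_nat_mult)
  have ee: "e * e = 1"
    unfolding e_def by (simp flip: power_add mult_2)
  have pow: "(- x) ^ Suc n = - e * x ^ Suc n"
    unfolding e_def by (simp add: power_minus[of x])
  have "of_nat (2 * Suc n choose Suc n) = 2 * d"
    unfolding d_def using central_binomial_Suc(1)[of n] by (metis of_nat_mult of_nat_numeral)
  then have "2 * poly (S_poly (Suc n) (Suc n)) x
      = - e * ((1 - x)\<^sup>2 * A - (1 - x) * c * (- x) ^ Suc n + d * (- x) ^ Suc n) / d"
    unfolding poly_S_poly_central[of "Suc n"] sum_central_binomial_truncated_Suc A_def c_def d_def e_def
    by (simp del: binomial_Suc_Suc)
  also have "\<dots> = - e * (1 - x)\<^sup>2 * A / d - (1 - x) * (e * e) * c * x ^ Suc n / d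
      + (e * e) * x ^ Suc n"
    unfolding pow using nz by (simp add: field_simps del: power_Suc)
  also have "\<dots> = (c / d) * ((x - 1) * (x ^ Suc n - (x - 1) * (e * A / c))) + x ^ Suc n"
    unfolding ee using nz by (simp add: field_simps power2_eq_square del: power_Suc)
  \<comment> \<open>The quotient of the normalising binomial coefficients is what yields the factor
    \<open>(n + 1) / (2 * n + 1)\<close>.\<close>
  also have "c / d = p / q"
    using pd nz by (simp add: field_simps)
  also have "e * A / c = poly (S_poly n n) x"
    unfolding poly_S_poly_central A_def c_def e_def ..
  finally show ?thesis
    unfolding p_def q_def .
qed

section \<open>Powers of two in central binomial coefficients\<close>

text \<open>Adding 1 clears the trailing ones of \<open>n\<close> and sets the next digit. The
  number of ones cleared is the 2-adic valuation of \<open>Suc n\<close>.\<close>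

lemma binary_digit_sum_Suc:
  "binary_digit_sum (Suc n) + multiplicity 2 (Suc n) = Suc (binary_digit_sum n)"
proof (induction n rule: less_induct)
  case (less n)
  show ?case
  proof (cases "even n")
    case True
    then obtain m where m: "n = 2 * m" by (elim evenE)
    then have "multiplicity 2 (Suc n) = 0"
      by (intro not_dvd_imp_multiplicity_0) simp
    moreover have "binary_digit_sum (Suc n) = Suc (binary_digit_sum m)"
      using m by (subst binary_digit_sum.simps) simp
    moreover have "binary_digit_sum n = binary_digit_sum m"
      using m by (subst binary_digit_sum.simps) (simp add: binary_digit_sum.simps[of 0])
    ultimately show ?thesis by simp
  next
    case False
    then obtain m where m: "n = 2 * m + 1" by (elim oddE)
    have eq: "Suc n = 2 * Suc m" using m by simp
    then have "multiplicity 2 (Suc n) = Suc (multiplicity 2 (Suc m))"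
      by (metis multiplicity_times_same nat.simps(3) odd_one zero_neq_numeral)
    moreover have "binary_digit_sum (Suc n) = binary_digit_sum (Suc m)"
      unfolding eq by (subst binary_digit_sum.simps) simp
    moreover have "binary_digit_sum n = Suc (binary_digit_sum m)"
      using m by (subst binary_digit_sum.simps) simp
    moreover have "binary_digit_sum (Suc m) + multiplicity 2 (Suc m) = Suc (binary_digit_sum m)"
      using m by (intro less.IH) simp
    ultimately show ?thesis by simp
  qed
qed

text \<open>As \<open>2 * n + 1\<close> is odd, passing from \<open>n\<close> to
  \<open>Suc n\<close> changes the valuation by 1 minus that of \<open>Suc n\<close>, exactly as it
  changes the digit sum.\<close>

lemma multiplicity_2_central_binomial:
  "multiplicity 2 (2 * n choose n) = binary_digit_sum n"
proof (induction n)
  case 0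
  then show ?case by (simp add: binary_digit_sum.simps[of 0])
next
  case (Suc n)
  have "Suc n * (2 * Suc n choose Suc n) = 2 * (Suc (2 * n) * (2 * n choose n))"
    using central_binomial_Suc[of n] by (metis mult.left_commute)
  then have "multiplicity 2 (Suc n * (2 * Suc n choose Suc n))
      = multiplicity 2 (2 * (Suc (2 * n) * (2 * n choose n)))"
    by (rule arg_cong)
  moreover have "multiplicity 2 (Suc n * (2 * Suc n choose Suc n))
      = multiplicity 2 (Suc n) + multiplicity 2 (2 * Suc n choose Suc n)"
    by (intro prime_elem_multiplicity_mult_distrib) (auto simp del: binomial_Suc_Suc)
  moreover have "multiplicity 2 (2 * (Suc (2 * n) * (2 * n choose n)))
      = Suc (multiplicity 2 (Suc (2 * n) * (2 * n choose n)))"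
    by (intro multiplicity_times_same) auto
  moreover have "multiplicity 2 (Suc (2 * n) * (2 * n choose n))
      = multiplicity 2 (Suc (2 * n)) + multiplicity 2 (2 * n choose n)"
    by (intro prime_elem_multiplicity_mult_distrib) auto
  moreover have "multiplicity 2 (Suc (2 * n)) = 0"
    by (intro not_dvd_imp_multiplicity_0) simp
  ultimately show ?case
    using Suc.IH binary_digit_sum_Suc[of n] by linarith
qed

section \<open>Denominators of the values at integers\<close>

lemma multiplicity_int: "multiplicity (int p) (int m) = multiplicity p m"
  unfolding multiplicity_def by (simp only: of_nat_dvd_iff flip: of_nat_power)

text \<open>The fraction need not be reduced, but cancelling removes no factor \<open>p\<close>,
  since \<open>p\<close> does not divide the numerator.\<close>

lemma multiplicity_denom:
  fixes a b p :: int
  assumes "prime p" "\<not> p dvd a" "b \<noteq> 0"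
  shows "multiplicity p (denom (of_int a / of_int b)) = multiplicity p b"
proof -
  obtain u d where ud: "quotient_of (of_int a / of_int b) = (u, d)"
    by (cases "quotient_of (of_int a / of_int b)")
  have d: "d > 0" and cop: "coprime u d"
    using ud quotient_of_denom_pos quotient_of_coprime by blast+
  have "(of_int a / of_int b :: rat) = of_int u / of_int d"
    using ud by (rule quotient_of_div)
  then have "(of_int (a * d) :: rat) = of_int (u * b)"
    using d assms by (simp add: field_simps)
  then have eq: "a * d = u * b"
    by (simp only: of_int_eq_iff)
  have "a \<noteq> 0" using assms by auto
  then have "u \<noteq> 0" using eq d by auto
  have "multiplicity p (a * d) = multiplicity p d"
    using assms d \<open>a \<noteq> 0\<close>
    by (subst prime_elem_multiplicity_mult_distrib) (auto simp: not_dvd_imp_multiplicity_0)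
  moreover have "multiplicity p (u * b) = multiplicity p u + multiplicity p b"
    using assms \<open>u \<noteq> 0\<close> by (intro prime_elem_multiplicity_mult_distrib) auto
  moreover have "multiplicity p u = 0"
  proof (rule not_dvd_imp_multiplicity_0, rule notI)
    assume "p dvd u"
    then have "\<not> p dvd d"
      using cop assms(1) by (meson coprime_common_divisor not_prime_unit)
    moreover have "p dvd a * d" using \<open>p dvd u\<close> eq by simp
    ultimately show False
      using assms by (simp add: prime_dvd_mult_iff)
  qed
  ultimately show ?thesis
    using ud eq by (simp add: denom_def)
qed

text \<open>In the recurrence one even factor \<open>l - 1\<close> cancels the 2 below
  \<open>S_poly n n\<close>, and the other keeps that summand even over odd. Adding the odd
  \<open>l ^ Suc n\<close> makes the doubled value odd over odd.\<close>

lemma S_poly_central_odd: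
  assumes "odd l" "n \<ge> 1"
  shows "\<exists>a b. odd a \<and> odd b \<and> poly (S_poly n n) (of_int l) = of_int a / of_int (2 * b)"
  using assms(2)
proof (induction n rule: dec_induct)
  case base
  have "poly (S_poly 1 1) (of_int l) = of_int (2 * l - 1) / of_int (2 * 1)"
    unfolding poly_S_poly_central by (simp add: field_simps)
  then show ?case
    by (intro exI[of _ "2 * l - 1"] exI[of _ 1]) simp
next
  case (step n)
  then obtain a b where ab: "odd a" "odd b" "poly (S_poly n n) (of_int l) = of_int a / of_int (2 * b)"
    by auto
  obtain m where m: "l = 2 * m + 1" using assms(1) by (rule oddE)
  define q where "q = 1 + 2 * int n"
  define u where "u = l ^ Suc n"
  have "odd q" "odd u" unfolding q_def u_def using assms by auto
  then have nz: "q \<noteq> 0" "b \<noteq> 0" using ab by auto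
  have l1: "(of_int l - 1 :: rat) = 2 * of_int m"
    using m by simp
  have "of_nat (Suc (2 * n)) = (of_int q :: rat)" unfolding q_def by simp
  moreover have "of_int l ^ Suc n = (of_int u :: rat)" unfolding u_def by (simp del: power_Suc)
  ultimately have "2 * poly (S_poly (Suc n) (Suc n)) (of_int l) =
      of_nat (Suc n) / of_int q * (2 * of_int m * (of_int u - 2 * of_int m * (of_int a / of_int (2 * b))))
      + of_int u"
    unfolding poly_S_poly_central_Suc ab(3) l1 by (simp only:)
  \<comment> \<open>Denominators are cleared for arbitrary rationals, keeping the casts from
    \<open>int\<close> out of the algebra.\<close>
  moreover have "z = (2 * (N * m * (u * b - m * a)) + u * (q * b)) / (2 * (q * b))"
    if "2 * z = N / q * (2 * m * (u - 2 * m * (a / (2 * b)))) + u" "q \<noteq> 0" "b \<noteq> 0"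
    for z N m u a b q :: rat
  proof -
    have "2 * z = N / q * (2 * m * (u - m * a / b)) + u" using that by simp
    also have "\<dots> = (2 * (N * m * (u * b - m * a)) + u * (q * b)) / (q * b)"
      using that(2,3) by (simp add: field_simps)
    finally show ?thesis using that(2,3) by (simp add: eq_divide_eq mult.assoc mult.left_commute)
  qed
  ultimately have "poly (S_poly (Suc n) (Suc n)) (of_int l) =
      of_int (2 * (int (Suc n) * m * (u * b - m * a)) + u * (q * b)) / of_int (2 * (q * b))"
    using nz by (simp only: of_int_add of_int_mult of_int_diff of_int_numeral of_int_of_nat_eq
        of_int_eq_0_iff not_False_eq_True)
  moreover have "odd (2 * (int (Suc n) * m * (u * b - m * a)) + u * (q * b))" "odd (q * b)"
    using \<open>odd q\<close> \<open>odd u\<close> ab by auto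
  ultimately show ?case by blast
qed

lemma multiplicity_denom_S_poly_central:
  assumes "n \<ge> 1"
  shows "multiplicity 2 (denom (poly (S_poly n n) (of_int l)))
    = (if odd l then 1 else binary_digit_sum n)"
proof (cases "odd l")
  case True
  then obtain a b where ab: "odd a" "odd b"
      "poly (S_poly n n) (of_int l) = of_int a / of_int (2 * b)"
    using S_poly_central_odd assms by blast
  then have "multiplicity 2 (denom (poly (S_poly n n) (of_int l))) = multiplicity 2 (2 * b)"
    by (simp only:) (intro multiplicity_denom, auto)
  also have "\<dots> = Suc (multiplicity 2 b)"
    using ab by (intro multiplicity_times_same) auto
  finally show ?thesis
    using True ab by (simp add: not_dvd_imp_multiplicity_0)
next
  case False
  define a where "a = (-1) ^ n * (\<Sum>k\<le>n. int (2 * n choose k) * (- l) ^ k)"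
  \<comment> \<open>For even \<open>l\<close> only the term at \<open>k = 0\<close>, which is 1, is
    odd.\<close>
  have "even (\<Sum>k\<in>{..n} - {0}. int (2 * n choose k) * (- l) ^ k)"
    using False by (intro dvd_sum) auto
  then have "odd a"
    unfolding a_def by (simp add: sum.remove[of "{..n}" 0])
  have "poly (S_poly n n) (of_int l) = of_int a / of_int (int (2 * n choose n))"
    unfolding poly_S_poly_central a_def by simp
  then have "multiplicity 2 (denom (poly (S_poly n n) (of_int l))) = multiplicity 2 (int (2 * n choose n))"
    using \<open>odd a\<close> by (simp only:) (intro multiplicity_denom, auto)
  also have "\<dots> = multiplicity 2 (2 * n choose n)"
    using multiplicity_int[of 2 "2 * n choose n"] by simp
  finally show ?thesis
    using False by (simp add: multiplicity_2_central_binomial)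
qed

text \<open>This makes the valuation of the denominator positive for even \<open>l\<close> as well,
  so no value is an integer.\<close>

lemma binary_digit_sum_pos: "n \<ge> 1 \<Longrightarrow> binary_digit_sum n \<ge> 1"
proof (induction n rule: less_induct)
  case (less n)
  then show ?case
    by (cases "even n"; subst binary_digit_sum.simps) (auto simp: odd_iff_mod_2_eq_one elim!: evenE)
qed

theorem theorem3p4:
  fixes n :: nat
  assumes "n \<ge> 1"
  shows "S_poly n n =
           smult (inverse (of_nat ((2 * n) choose n)))
             (\<Sum>k=0..n. smult (of_nat ((2 * n) choose k) * (-1) ^ (n - k)) (indet ^ k))
       \<and> 2 * S_poly (n + 1) (n + 1) =
           smult (of_nat (n + 1) / of_nat (2 * n + 1))
             ((indet - 1) * (indet ^ (n + 1) - (indet - 1) * S_poly n n))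
           + indet ^ (n + 1)
       \<and> S_poly 1 1 = indet - [:1 / 2:]
       \<and> (\<forall>l :: int. poly (S_poly n n) (of_int l) \<notin> \<int>)
       \<and> (\<forall>l :: int. multiplicity 2 (denom (poly (S_poly n n) (of_int l))) =
           (if odd l then 1 else binary_digit_sum n))"
proof (intro conjI allI)
  show "S_poly n n = smult (inverse (of_nat ((2 * n) choose n)))
      (\<Sum>k=0..n. smult (of_nat ((2 * n) choose k) * (-1) ^ (n - k)) (indet ^ k))"
    by (rule S_poly_central)
  show "2 * S_poly (n + 1) (n + 1) = smult (of_nat (n + 1) / of_nat (2 * n + 1))
      ((indet - 1) * (indet ^ (n + 1) - (indet - 1) * S_poly n n)) + indet ^ (n + 1)"
  \<comment> \<open>Over the infinite field of rationals, polynomials with the same values are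
    equal.\<close>
  proof (rule iffD1[OF poly_eq_poly_eq_iff], rule ext)
    fix x
    show "poly (2 * S_poly (n + 1) (n + 1)) x = poly (smult (of_nat (n + 1) / of_nat (2 * n + 1))
        ((indet - 1) * (indet ^ (n + 1) - (indet - 1) * S_poly n n)) + indet ^ (n + 1)) x"
      using poly_S_poly_central_Suc[of n x] by simp
  qed
  show "S_poly 1 1 = indet - [:1 / 2:]"
    by (simp add: S_poly_def)
  fix l :: int
  let ?s = "poly (S_poly n n) (of_int l)"
  show mult: "multiplicity 2 (denom ?s) = (if odd l then 1 else binary_digit_sum n)"
    using assms by (rule multiplicity_denom_S_poly_central)
  show "?s \<notin> \<int>"
  proof
    assume "?s \<in> \<int>"
    then obtain z where "?s = of_int z" by (elim Ints_cases)
    then have "denom ?s = 1" by (simp add: denom_def)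
    then show False
      using mult binary_digit_sum_pos[OF assms] by (simp split: if_splits)
  qed
qed

end
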